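(* Let $\gamma:J\to S$ be a smooth regular curve on a surface $S\subset\mathbb{R}^3$ with nowhere vanishing normal curvature $\kappa_n$, and let $\tilde\gamma:J\to\tilde S$ be its development curve in a plane $\tilde S$. Then the map sending the point $r(t,u)$ of the Cartan surface ribbon along $\gamma$ to the point $$\tilde r(t,u)=\tilde\gamma(t)+u\,\frac{\omega_t}{\|\omega_t\|}=\tilde\gamma(t)+u\,\frac{\omega_t}{\sqrt{\kappa_n^2(t)+\tau_g^2(t)}}$$ is an isometry from the Cartan surface ribbon onto the associated Cartan planar ribbon parametrized by $\tilde r$.
   Context: $J=[0,\alpha]$, $\gamma(0)=(0,0,0)$. The Darboux frame field of $\gamma$ is $\{e,h,N\}$, where $N(t)$ is a (smoothly chosen) unit normal vector to $S$ at $\gamma(t)$, $e(t)=\gamma'(t)/\|\gamma'(t)\|$ and $h(t)=N(t)\times e(t)$. The geodesic curvature $\kappa_g$, normal curvature $\kappa_n$ and geodesic torsion $\tau_g$ are defined by $e'=\|\gamma'\|(\kappa_g h+\kappa_n N)$, $h'=\|\gamma'\|(-\kappa_g e+\tau_g N)$, $N'=\|\gamma'\|(-\kappa_n e-\tau_g h)$. The development curve $\tilde\gamma$ is the smooth curve in the plane $\tilde S$ (constant unit normal $\tilde e_3$) with $\tilde\gamma(0)=\gamma(0)$, $\tilde\gamma'(0)=\gamma'(0)$, $\|\tilde\gamma'\|=\|\gamma'\|$, and signed curvature $\tilde\kappa_g(t)=\kappa_g(t)$ for all $t$ with respect to the frame $\tilde e=\tilde\gamma'/\|\tilde\gamma'\|$,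 $\tilde h=\tilde e_3\times\tilde e$. It is the contact curve of the standard rolling of $S$ along $\gamma$ on the plane. Put $\hat\omega_t=\kappa_n(t)h(t)-\tau_g(t)e(t)$ and $\omega_t=\kappa_n(t)\tilde h(t)-\tau_g(t)\tilde e(t)$ (the angular velocity vector of the rolling and its pull-back, up to the factor $\|\gamma'\|$). The Cartan surface ribbon along $\gamma$ is the developable surface $r(t,u)=\gamma(t)+u\,\hat\omega_t/\|\hat\omega_t\|$, $t\in J$, $u\in[-w_-(t),w_+(t)]$, where $w_\pm$ are positive functions on $J$ such that $r$ is regular ($r_t,r_u$ linearly independent everywhere). The associated Cartan planar ribbon is $\tilde r$ on the same parameter domain. Ribbons are regarded as parametrized surfaces, and isometry means that the first fundamental forms of $r(t,u)$ and $\tilde r(t,u)$ have identical coordinate functions. *)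

theory Defs
  imports "HOL-Analysis.Analysis"
begin

text \<open>
  Smoothness (class C-infinity). The function \<open>F [v\<^sub>k, \<dots>, v\<^sub>1]\<close> is the iterated directional
  derivative of \<open>f\<close> along \<open>v\<^sub>1\<close>, then \<open>v\<^sub>2\<close>, and so on. On a compact interval the derivatives at
  the two endpoints are one-sided.
\<close>
definition smooth_on :: "'a::real_normed_vector set \<Rightarrow> ('a \<Rightarrow> 'b::real_normed_vector) \<Rightarrow> bool"
  where "smooth_on A f \<longleftrightarrow>
    (\<exists>F :: 'a list \<Rightarrow> 'a \<Rightarrow> 'b.
        (\<forall>x\<in>A. F [] x = f x) \<and>
        (\<forall>vs. \<forall>x\<in>A. (F vs has_derivative (\<lambda>v. F (v # vs) x)) (at x within A)))"

definition regular_surface :: "(real^3) set \<Rightarrow> bool"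
  where "regular_surface S \<longleftrightarrow>
    (\<forall>p\<in>S. \<exists>(U :: (real^2) set) V x y.
        open U \<and> open V \<and> p \<in> V \<and> homeomorphism U (S \<inter> V) x y \<and>
        smooth_on U x \<and> (\<forall>q\<in>U. inj (frechet_derivative x (at q))))"

definition tangent_plane :: "(real^3) set \<Rightarrow> real^3 \<Rightarrow> (real^3) set"
  where "tangent_plane S p =
    {v. \<exists>\<epsilon>>0. \<exists>c. smooth_on {-\<epsilon><..<\<epsilon>} c \<and> c ` {-\<epsilon><..<\<epsilon>} \<subseteq> S \<and> c 0 = p \<and>
          (c has_vector_derivative v) (at 0)}"

abbreviation velocity :: "real set \<Rightarrow> (real \<Rightarrow> real^3) \<Rightarrow> real \<Rightarrow> real^3"
  where "velocity J c t \<equiv> vector_derivative c (at t within J)"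

definition regular_curve :: "real set \<Rightarrow> (real \<Rightarrow> real^3) \<Rightarrow> bool"
  where "regular_curve J c \<longleftrightarrow> smooth_on J c \<and> (\<forall>t\<in>J. velocity J c t \<noteq> 0)"

definition unit_normal_along ::
    "(real^3) set \<Rightarrow> real set \<Rightarrow> (real \<Rightarrow> real^3) \<Rightarrow> (real \<Rightarrow> real^3) \<Rightarrow> bool"
  where "unit_normal_along S J c N \<longleftrightarrow>
    smooth_on J N \<and>
    (\<forall>t\<in>J. norm (N t) = 1 \<and> (\<forall>v\<in>tangent_plane S (c t). N t \<bullet> v = 0))"

text \<open>
  The Darboux frame of \<open>c\<close> is \<open>tangent\<close>, \<open>conormal\<close>, \<open>N\<close>. For a plane curve the same definitions
  are used with the constant unit normal \<open>\<lambda>_. n\<close> of the plane.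
\<close>
definition tangent :: "real set \<Rightarrow> (real \<Rightarrow> real^3) \<Rightarrow> real \<Rightarrow> real^3"
  where "tangent J c t = velocity J c t /\<^sub>R norm (velocity J c t)"

definition conormal ::
    "real set \<Rightarrow> (real \<Rightarrow> real^3) \<Rightarrow> (real \<Rightarrow> real^3) \<Rightarrow> real \<Rightarrow> real^3"
  where "conormal J c N t = cross3 (N t) (tangent J c t)"

text \<open>
  Geodesic curvature \<open>kg\<close>, normal curvature \<open>kn\<close> and geodesic torsion \<open>tg\<close> are the coefficients
  in the Darboux equations. They exist and are unique on \<open>J\<close> whenever \<open>c\<close> is regular and \<open>N\<close> is a
  smooth unit field orthogonal to it; existence is \<open>Darboux_curvatures_exist\<close> below.
\<close>
definition Darboux_curvatures ::
    "real set \<Rightarrow> (real \<Rightarrow> real^3) \<Rightarrow> (real \<Rightarrow> real^3) \<Rightarrow>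
      (real \<Rightarrow> real) \<Rightarrow> (real \<Rightarrow> real) \<Rightarrow> (real \<Rightarrow> real) \<Rightarrow> bool"
  where "Darboux_curvatures J c N kg kn tg \<longleftrightarrow>
    (let e = tangent J c; h = conormal J c N; v = \<lambda>t. norm (velocity J c t) in
      \<forall>t\<in>J.
        (e has_vector_derivative v t *\<^sub>R (kg t *\<^sub>R h t + kn t *\<^sub>R N t)) (at t within J) \<and>
        (h has_vector_derivative v t *\<^sub>R (- kg t *\<^sub>R e t + tg t *\<^sub>R N t)) (at t within J) \<and>
        (N has_vector_derivative v t *\<^sub>R (- kn t *\<^sub>R e t - tg t *\<^sub>R h t)) (at t within J))"

definition signed_curvature ::
    "real set \<Rightarrow> (real \<Rightarrow> real^3) \<Rightarrow> real^3 \<Rightarrow> (real \<Rightarrow> real) \<Rightarrow> bool"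
  where "signed_curvature J c n k \<longleftrightarrow>
    (\<forall>t\<in>J. (tangent J c has_vector_derivative
        norm (velocity J c t) *\<^sub>R k t *\<^sub>R conormal J c (\<lambda>_. n) t) (at t within J))"

text \<open>
  Development on the plane \<open>P\<close> with unit normal \<open>n\<close> of a curve \<open>c\<close> that starts at parameter 0 and
  has geodesic curvature \<open>kg\<close>.
\<close>
definition development_curve ::
    "real set \<Rightarrow> (real \<Rightarrow> real^3) \<Rightarrow> (real \<Rightarrow> real) \<Rightarrow> (real^3) set \<Rightarrow> real^3 \<Rightarrow>
      (real \<Rightarrow> real^3) \<Rightarrow> bool"
  where "development_curve J c kg P n c' \<longleftrightarrow>
    smooth_on J c' \<and> c' ` J \<subseteq> P \<and>
    c' 0 = c 0 \<and> velocity J c' 0 = velocity J c 0 \<and>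
    (\<forall>t\<in>J. norm (velocity J c' t) = norm (velocity J c t)) \<and>
    signed_curvature J c' n kg"

text \<open>
  Angular velocity vector of the rolling, up to the speed factor. With the Darboux frame on the
  surface it is the spatial vector; with the frame of the development curve in the plane it is
  the pull-back.
\<close>
definition rolling_axis ::
    "real set \<Rightarrow> (real \<Rightarrow> real^3) \<Rightarrow> (real \<Rightarrow> real^3) \<Rightarrow>
      (real \<Rightarrow> real) \<Rightarrow> (real \<Rightarrow> real) \<Rightarrow> real \<Rightarrow> real^3"
  where "rolling_axis J c N kn tg t = kn t *\<^sub>R conormal J c N t - tg t *\<^sub>R tangent J c t"

definition ruled :: "(real \<Rightarrow> real^3) \<Rightarrow> (real \<Rightarrow> real^3) \<Rightarrow> real \<times> real \<Rightarrow> real^3"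
  where "ruled c w = (\<lambda>(t, u). c t + u *\<^sub>R (w t /\<^sub>R norm (w t)))"

definition ribbon_domain ::
    "real set \<Rightarrow> (real \<Rightarrow> real) \<Rightarrow> (real \<Rightarrow> real) \<Rightarrow> (real \<times> real) set"
  where "ribbon_domain J wm wp = (SIGMA t:J. {- wm t..wp t})"

text \<open>
  Partial derivatives of a parametrized surface given on all of \<open>J \<times> \<real>\<close>. They are taken there and
  not within a ribbon domain, whose slices in the \<open>t\<close>-direction need not be intervals.
\<close>
abbreviation partial_t :: "real set \<Rightarrow> (real \<times> real \<Rightarrow> real^3) \<Rightarrow> real \<times> real \<Rightarrow> real^3"
  where "partial_t J r p \<equiv> vector_derivative (\<lambda>s. r (s, snd p)) (at (fst p) within J)"

abbreviation partial_u :: "(real \<times> real \<Rightarrow> real^3) \<Rightarrow> real \<times> real \<Rightarrow> real^3"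
  where "partial_u r p \<equiv> vector_derivative (\<lambda>v. r (fst p, v)) (at (snd p))"

definition partials_exist ::
    "real set \<Rightarrow> (real \<times> real) set \<Rightarrow> (real \<times> real \<Rightarrow> real^3) \<Rightarrow> bool"
  where "partials_exist J D r \<longleftrightarrow>
    (\<forall>p\<in>D. (\<lambda>s. r (s, snd p)) differentiable (at (fst p) within J) \<and>
           (\<lambda>v. r (fst p, v)) differentiable (at (snd p)))"

definition regular_parametrization ::
    "real set \<Rightarrow> (real \<times> real) set \<Rightarrow> (real \<times> real \<Rightarrow> real^3) \<Rightarrow> bool"
  where "regular_parametrization J D r \<longleftrightarrow>
    (\<forall>p\<in>D. \<forall>a b. a *\<^sub>R partial_t J r p + b *\<^sub>R partial_u r p = 0 \<longrightarrow> a = 0 \<and> b = 0)"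

text \<open>
  Isometry of parametrized surfaces over the same parameter domain: the map \<open>r p \<mapsto> r' p\<close>
  preserves the coefficients E, F, G of the first fundamental form.
\<close>
definition isometric_parametrizations ::
    "real set \<Rightarrow> (real \<times> real) set \<Rightarrow>
      (real \<times> real \<Rightarrow> real^3) \<Rightarrow> (real \<times> real \<Rightarrow> real^3) \<Rightarrow> bool"
  where "isometric_parametrizations J D r r' \<longleftrightarrow>
    partials_exist J D r \<and> partials_exist J D r' \<and>
    (\<forall>p\<in>D.
        partial_t J r p \<bullet> partial_t J r p = partial_t J r' p \<bullet> partial_t J r' p \<and>
        partial_t J r p \<bullet> partial_u r p = partial_t J r' p \<bullet> partial_u r' p \<and>
        partial_u r p \<bullet> partial_u r p = partial_u r' p \<bullet> partial_u r' p)"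

lemma smooth_on_interval_deriv:
  fixes c :: "real \<Rightarrow> 'b::real_normed_vector"
  assumes "smooth_on {0..\<alpha>} c" "0 < \<alpha>"
  obtains c1 c2 where
    "\<And>t. t \<in> {0..\<alpha>} \<Longrightarrow> (c has_vector_derivative c1 t) (at t within {0..\<alpha>})"
    "\<And>t. t \<in> {0..\<alpha>} \<Longrightarrow> (c1 has_vector_derivative c2 t) (at t within {0..\<alpha>})"
    "\<And>t. t \<in> {0..\<alpha>} \<Longrightarrow> vector_derivative c (at t within {0..\<alpha>}) = c1 t"
proof -
  obtain F where F0: "\<And>x. x \<in> {0..\<alpha>} \<Longrightarrow> F [] x = c x"
    and F: "\<And>vs x. x \<in> {0..\<alpha>} \<Longrightarrow>
              (F vs has_derivative (\<lambda>v. F (v # vs) x)) (at x within {0..\<alpha>})"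
    using assms(1) unfolding smooth_on_def by metis
  have D: "(F vs has_vector_derivative F (1 # vs) t) (at t within {0..\<alpha>})"
    if "t \<in> {0..\<alpha>}" for vs t
  proof -
    have "linear (\<lambda>v. F (v # vs) t)"
      using F[OF that, of vs] by (rule has_derivative_linear)
    from linear_cmul[OF this, of _ 1]
    have "(\<lambda>v. F (v # vs) t) = (\<lambda>v. v *\<^sub>R F (1 # vs) t)"
      by (intro ext) (metis mult.right_neutral real_scaleR_def)
    with F[OF that, of vs] show ?thesis
      by (simp add: has_vector_derivative_def)
  qed
  have c: "(c has_vector_derivative F [1] t) (at t within {0..\<alpha>})" if "t \<in> {0..\<alpha>}" for t
    by (rule has_vector_derivative_transform[OF that _ D[OF that]]) (simp add: F0)
  show ?thesis
  proof
    show "(F [1] has_vector_derivative F [1, 1] t) (at t within {0..\<alpha>})" if "t \<in> {0..\<alpha>}" for t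
      using D[OF that] .
    show "vector_derivative c (at t within {0..\<alpha>}) = F [1] t" if "t \<in> {0..\<alpha>}" for t
      using vector_derivative_within_cbox[of 0 \<alpha> t c "F [1] t"] c[OF that] that assms(2)
      by (simp add: box_real)
  qed (use c in auto)
qed

lemma orthonormal_expansion:
  fixes e N w :: "real^3"
  assumes "norm e = 1" "norm N = 1" "N \<bullet> e = 0"
  shows "w = (w \<bullet> e) *\<^sub>R e + (w \<bullet> cross3 N e) *\<^sub>R cross3 N e + (w \<bullet> N) *\<^sub>R N"
proof -
  let ?h = "cross3 N e"
  let ?z = "w - ((w \<bullet> e) *\<^sub>R e + (w \<bullet> ?h) *\<^sub>R ?h + (w \<bullet> N) *\<^sub>R N)"
  have 1: "e \<bullet> e = 1" "N \<bullet> N = 1" "e \<bullet> N = 0"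
    using assms by (auto simp: norm_eq_1 inner_commute)
  have hh: "?h \<bullet> ?h = 1"
    using norm_cross_dot[of N e] assms by (simp add: power2_norm_eq_inner)
  have o: "?h \<bullet> e = 0" "?h \<bullet> N = 0" "e \<bullet> ?h = 0" "N \<bullet> ?h = 0"
    by (simp_all add: dot_cross_self)
  have ze: "?z \<bullet> e = 0" "?z \<bullet> N = 0" "?z \<bullet> ?h = 0"
    using assms 1 hh o by (simp_all add: inner_diff_left inner_add_left)
  have "?z = 0"
  proof (rule cross_dot_cancel)
    show "?h \<bullet> ?z = ?h \<bullet> 0" using ze(3) by (simp add: inner_commute)
    have "cross3 ?z ?h = 0" using ze by (simp add: Lagrange)
    then show "cross3 ?h ?z = cross3 ?h 0" by (metis cross_skew cross_zero_right neg_0_equal_iff_equal)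
    show "?h \<noteq> 0" using hh by auto
  qed
  then show ?thesis by simp
qed

lemma unit_normal_orthogonal_velocity:
  assumes "0 < \<alpha>" "smooth_on {0..\<alpha>} \<gamma>" "\<gamma> ` {0..\<alpha>} \<subseteq> S"
    "unit_normal_along S {0..\<alpha>} \<gamma> N" "t \<in> {0..\<alpha>}"
  shows "N t \<bullet> velocity {0..\<alpha>} \<gamma> t = 0"
proof -
  let ?J = "{0..\<alpha>}"
  obtain c1 c2 where
    d1: "\<And>t. t \<in> ?J \<Longrightarrow> (\<gamma> has_vector_derivative c1 t) (at t within ?J)" and
    d2: "\<And>t. t \<in> ?J \<Longrightarrow> (c1 has_vector_derivative c2 t) (at t within ?J)" and
    v: "\<And>t. t \<in> ?J \<Longrightarrow> velocity ?J \<gamma> t = c1 t"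
    using smooth_on_interval_deriv[OF assms(2,1)] by metis
  obtain F where F0: "\<And>x. x \<in> ?J \<Longrightarrow> F [] x = \<gamma> x"
    and F: "\<And>vs x. x \<in> ?J \<Longrightarrow> (F vs has_derivative (\<lambda>v. F (v # vs) x)) (at x within ?J)"
    using assms(2) unfolding smooth_on_def by metis
  obtain N1 N2 where
    n1: "\<And>t. t \<in> ?J \<Longrightarrow> (N has_vector_derivative N1 t) (at t within ?J)"
    using smooth_on_interval_deriv[of \<alpha> N] assms(1,4) unfolding unit_normal_along_def by metis
  have int: "N t \<bullet> c1 t = 0" if t: "t \<in> {0<..<\<alpha>}" for t
  proof -
    define \<epsilon> where "\<epsilon> = min t (\<alpha> - t)"
    let ?I = "{-\<epsilon><..<\<epsilon>}"
    have eps: "\<epsilon> > 0" using t by (auto simp: \<epsilon>_def)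
    have sub: "(\<lambda>s. t + s) ` ?I \<subseteq> ?J" by (auto simp: \<epsilon>_def)
    let ?c = "\<lambda>s. \<gamma> (t + s)"
    have "smooth_on ?I ?c"
      unfolding smooth_on_def
    proof (intro exI conjI ballI allI)
      show "(\<lambda>vs s. F vs (t + s)) [] s = ?c s" if "s \<in> ?I" for s
        using F0[of "t + s"] sub that by blast
      show "((\<lambda>vs s. F vs (t + s)) vs has_derivative (\<lambda>v. (\<lambda>vs s. F vs (t + s)) (v # vs) s)) (at s within ?I)"
        if "s \<in> ?I" for vs s
      proof -
        have "t + s \<in> ?J" using sub that by blast
        then have "(F vs has_derivative (\<lambda>v. F (v # vs) (t + s))) (at (t + s) within (\<lambda>s. t + s) ` ?I)"
          using F has_derivative_subset sub by blast
        moreover have "((\<lambda>s. t + s) has_derivative (\<lambda>v. v)) (at s within ?I)"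
          by (auto intro!: derivative_eq_intros)
        ultimately show ?thesis
          using has_derivative_in_compose[of "\<lambda>s. t + s" "\<lambda>v. v" s ?I "F vs"] by simp
      qed
    qed
    moreover have "?c ` ?I \<subseteq> S" using sub assms(3) by auto
    moreover have "(?c has_vector_derivative c1 t) (at 0)"
    proof -
      have tJ: "t \<in> interior ?J" using t by simp
      have "(\<gamma> has_vector_derivative c1 t) (at t)"
        using d1[of t] t at_within_interior[OF tJ] by auto
      then have "(\<gamma> has_vector_derivative c1 t) (at (t + 0))" by simp
      moreover have "((\<lambda>s. t + s) has_vector_derivative 1) (at 0)"
        by (auto simp: has_vector_derivative_def intro!: derivative_eq_intros)
      ultimately show ?thesis
        using vector_diff_chain_at[of "\<lambda>s. t + s" 1 0 \<gamma> "c1 t"] by (simp add: o_def)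
    qed
    ultimately have "c1 t \<in> tangent_plane S (\<gamma> t)"
      unfolding tangent_plane_def using eps by (auto intro!: exI[of _ \<epsilon>] exI[of _ ?c])
    then show ?thesis using assms(4) t unfolding unit_normal_along_def by auto
  qed
  have "continuous_on ?J (\<lambda>t. N t \<bullet> c1 t)"
    unfolding continuous_on_eq_continuous_within
    by (intro ballI continuous_inner has_vector_derivative_continuous[OF d2]
        has_vector_derivative_continuous[OF n1])
  then have "continuous_on (closure {0<..<\<alpha>}) (\<lambda>t. N t \<bullet> c1 t)"
    using assms(1) by simp
  then have "N t \<bullet> c1 t = 0"
    by (rule continuous_constant_on_closure) (use int assms in auto)
  then show ?thesis using v assms(5) by simp
qed

lemma Darboux_curvatures_exist:
  assumes "0 < \<alpha>" "regular_curve {0..\<alpha>} \<gamma>" "\<gamma> ` {0..\<alpha>} \<subseteq> S"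
    "unit_normal_along S {0..\<alpha>} \<gamma> N"
  shows "\<exists>kg kn tg. Darboux_curvatures {0..\<alpha>} \<gamma> N kg kn tg"
proof -
  let ?J = "{0..\<alpha>}"
  let ?e = "tangent ?J \<gamma>" and ?h = "conormal ?J \<gamma> N" and ?v = "\<lambda>t. norm (velocity ?J \<gamma> t)"
  have sm: "smooth_on ?J \<gamma>" "smooth_on ?J N"
    and nz: "\<And>t. t \<in> ?J \<Longrightarrow> velocity ?J \<gamma> t \<noteq> 0"
    and nN: "\<And>t. t \<in> ?J \<Longrightarrow> norm (N t) = 1"
    using assms(2,4) unfolding regular_curve_def unit_normal_along_def by blast+
  obtain c1 c2 where
    d2: "\<And>t. t \<in> ?J \<Longrightarrow> (c1 has_vector_derivative c2 t) (at t within ?J)" and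
    v: "\<And>t. t \<in> ?J \<Longrightarrow> velocity ?J \<gamma> t = c1 t"
    using smooth_on_interval_deriv[OF sm(1) assms(1)] by metis
  obtain N1 where
    n1: "\<And>t. t \<in> ?J \<Longrightarrow> (N has_vector_derivative N1 t) (at t within ?J)"
    using smooth_on_interval_deriv[OF sm(2) assms(1)] by metis
  have e: "norm (?e t) = 1" "N t \<bullet> ?e t = 0" if "t \<in> ?J" for t
    using nz[OF that] unit_normal_orthogonal_velocity[OF assms(1) sm(1) assms(3,4) that]
    by (auto simp: tangent_def)
  have "\<exists>e1. (?e has_vector_derivative e1) (at t within ?J)" if t: "t \<in> ?J" for t
  proof -
    have c1': "(c1 has_derivative (\<lambda>x. x *\<^sub>R c2 t)) (at t within ?J)"
      using d2[OF t] by (simp add: has_vector_derivative_def)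
    have "c1 t \<noteq> 0" using nz[OF t] v[OF t] by simp
    then have "((\<lambda>s. norm (c1 s)) has_derivative (\<lambda>x. (x *\<^sub>R c2 t) \<bullet> sgn (c1 t))) (at t within ?J)"
      using has_derivative_compose[OF c1' has_derivative_norm] by simp
    then have "(\<lambda>s. inverse (norm (c1 s)) *\<^sub>R c1 s) differentiable (at t within ?J)"
      using c1' \<open>c1 t \<noteq> 0\<close>
      by (intro differentiable_scaleR differentiable_inverse) (auto intro: differentiableI)
    then obtain e1 where
      "((\<lambda>s. inverse (norm (c1 s)) *\<^sub>R c1 s) has_vector_derivative e1) (at t within ?J)"
      using vector_derivative_works by blast
    then have "(?e has_vector_derivative e1) (at t within ?J)"
      by (rule has_vector_derivative_transform[rotated -1]) (use t v in \<open>auto simp: tangent_def\<close>)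
    then show ?thesis by blast
  qed
  then obtain e1 where
    e1: "\<And>t. t \<in> ?J \<Longrightarrow> (?e has_vector_derivative e1 t) (at t within ?J)" by metis
  interpret bilinear_cross: bounded_bilinear cross3
    using bilinear_cross bilinear_conv_bounded_bilinear by blast
  define h1 where "h1 t = cross3 (N t) (e1 t) + cross3 (N1 t) (?e t)" for t
  have h1: "(?h has_vector_derivative h1 t) (at t within ?J)" if "t \<in> ?J" for t
    using bilinear_cross.has_vector_derivative[OF n1[OF that] e1[OF that]]
    by (simp add: conormal_def[abs_def] h1_def)
  have h: "?h t \<bullet> ?h t = 1" "?h t \<bullet> ?e t = 0" "?h t \<bullet> N t = 0" if "t \<in> ?J" for t
    using norm_cross_dot[of "N t" "?e t"] e[OF that] nN[OF that]
    by (simp_all add: conormal_def dot_cross_self power2_norm_eq_inner)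
  have dot: "f1 \<bullet> g t + f t \<bullet> g1 = 0"
    if t: "t \<in> ?J" and const: "\<And>s. s \<in> ?J \<Longrightarrow> f s \<bullet> g s = k"
      and fd: "(f has_vector_derivative f1) (at t within ?J)"
      and gd: "(g has_vector_derivative g1) (at t within ?J)"
    for f g :: "real \<Rightarrow> real^3" and f1 g1 k t
  proof -
    have "((\<lambda>s. f s \<bullet> g s) has_vector_derivative f t \<bullet> g1 + f1 \<bullet> g t) (at t within ?J)"
      using bounded_bilinear.has_vector_derivative[OF bounded_bilinear_inner fd gd] .
    moreover have "((\<lambda>s. f s \<bullet> g s) has_vector_derivative 0) (at t within ?J)"
      by (rule has_vector_derivative_transform[OF t, of _ "\<lambda>_. k"]) (use const in auto)
    moreover have "t \<in> cbox 0 \<alpha>" using t by simp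
    ultimately have "f t \<bullet> g1 + f1 \<bullet> g t = 0"
      using vector_derivative_unique_within_closed_interval[OF assms(1), of t "\<lambda>s. f s \<bullet> g s"]
      by (simp only: box_real)
    then show ?thesis by simp
  qed
  define kg where "kg t = (e1 t \<bullet> ?h t) / ?v t" for t
  define kn where "kn t = (e1 t \<bullet> N t) / ?v t" for t
  define tg where "tg t = (h1 t \<bullet> N t) / ?v t" for t
  have main: "e1 t = ?v t *\<^sub>R (kg t *\<^sub>R ?h t + kn t *\<^sub>R N t) \<and>
      h1 t = ?v t *\<^sub>R (- kg t *\<^sub>R ?e t + tg t *\<^sub>R N t) \<and>
      N1 t = ?v t *\<^sub>R (- kn t *\<^sub>R ?e t - tg t *\<^sub>R ?h t)" if t: "t \<in> ?J" for t
  proof -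
    have k: "?v t * kg t = e1 t \<bullet> ?h t" "?v t * kn t = e1 t \<bullet> N t" "?v t * tg t = h1 t \<bullet> N t"
      using nz[OF t] by (auto simp: kg_def kn_def tg_def)
    have z1: "e1 t \<bullet> ?e t = 0"
      using dot[of t ?e ?e 1, OF t _ e1[OF t] e1[OF t]] e by (simp add: norm_eq_1 inner_commute)
    have z2: "h1 t \<bullet> ?h t = 0"
      using dot[of t ?h ?h 1, OF t _ h1[OF t] h1[OF t]] h by (simp add: inner_commute)
    have z3: "N1 t \<bullet> N t = 0"
      using dot[of t N N 1, OF t _ n1[OF t] n1[OF t]] nN by (simp add: norm_eq_1 inner_commute)
    have z4: "h1 t \<bullet> ?e t = - (e1 t \<bullet> ?h t)"
      using dot[of t ?h ?e 0, OF t _ h1[OF t] e1[OF t]] h by (simp add: inner_commute)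
    have z5: "N1 t \<bullet> ?e t = - (e1 t \<bullet> N t)"
      using dot[of t N ?e 0, OF t _ n1[OF t] e1[OF t]] e by (simp add: inner_commute)
    have z6: "N1 t \<bullet> ?h t = - (h1 t \<bullet> N t)"
      using dot[of t N ?h 0, OF t _ n1[OF t] h1[OF t]] h by (simp add: inner_commute)
    have w: "w = a *\<^sub>R ?e t + b *\<^sub>R ?h t + c *\<^sub>R N t"
      if "w \<bullet> ?e t = a" "w \<bullet> ?h t = b" "w \<bullet> N t = c" for w a b c
      using orthonormal_expansion[OF e(1)[OF t] nN[OF t] e(2)[OF t], of w] that
      by (simp add: conormal_def)
    show ?thesis
      using w[OF z1 k(1)[symmetric] k(2)[symmetric]]
        w[OF z4[folded k(1)] z2 k(3)[symmetric]]
        w[OF z5[folded k(2)] z6[folded k(3)] z3]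
      by (simp add: scaleR_add_right scaleR_diff_right)
  qed
  have "Darboux_curvatures ?J \<gamma> N kg kn tg"
    unfolding Darboux_curvatures_def Let_def
  proof (intro ballI conjI)
    fix t assume t: "t \<in> ?J"
    show "(?e has_vector_derivative ?v t *\<^sub>R (kg t *\<^sub>R ?h t + kn t *\<^sub>R N t)) (at t within ?J)"
      using e1[OF t] main[OF t] by simp
    show "(?h has_vector_derivative ?v t *\<^sub>R (- kg t *\<^sub>R ?e t + tg t *\<^sub>R N t)) (at t within ?J)"
      using h1[OF t] main[OF t] by simp
    show "(N has_vector_derivative ?v t *\<^sub>R (- kn t *\<^sub>R ?e t - tg t *\<^sub>R ?h t)) (at t within ?J)"
      using n1[OF t] main[OF t] by simp
  qed
  then show ?thesis by blast
qed

end

theory Submission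
  imports Defs
begin

text \<open>
  Expanding the ruled surface in the Darboux frame, the normal component of its \<open>t\<close>-derivative is
  proportional to \<open>\<kappa>\<^sub>n \<tau>\<^sub>g - \<tau>\<^sub>g \<kappa>\<^sub>n = 0\<close>. Hence both partial derivatives are combinations of the
  tangent and the conormal whose coefficients depend only on the speed, \<open>\<kappa>\<^sub>g\<close>, and the ratio of
  \<open>\<kappa>\<^sub>n\<close> and \<open>\<tau>\<^sub>g\<close>. The development has the same speed and geodesic curvature, so the planar ribbon
  has the same coefficients in its own orthonormal frame.
\<close>

section \<open>Derivatives of smooth curves and orthonormality of frames\<close>

lemma smooth_on_interval_differentiable:
  fixes c :: "real \<Rightarrow> real^3"
  assumes "smooth_on {0..\<alpha>} c" "0 < \<alpha>" "t \<in> {0..\<alpha>}"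
  shows "(c has_vector_derivative velocity {0..\<alpha>} c t) (at t within {0..\<alpha>})"
    and "velocity {0..\<alpha>} c differentiable (at t within {0..\<alpha>})"
proof -
  obtain c1 c2 where
    c1: "\<And>t. t \<in> {0..\<alpha>} \<Longrightarrow> (c has_vector_derivative c1 t) (at t within {0..\<alpha>})" and
    c2: "\<And>t. t \<in> {0..\<alpha>} \<Longrightarrow> (c1 has_vector_derivative c2 t) (at t within {0..\<alpha>})" and
    v: "\<And>t. t \<in> {0..\<alpha>} \<Longrightarrow> velocity {0..\<alpha>} c t = c1 t"
    using smooth_on_interval_deriv[OF assms(1,2)] by metis
  show "(c has_vector_derivative velocity {0..\<alpha>} c t) (at t within {0..\<alpha>})"
    using c1 v assms(3) by simp
  have "(velocity {0..\<alpha>} c has_vector_derivative c2 t) (at t within {0..\<alpha>})"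
    by (rule has_vector_derivative_transform[OF assms(3) _ c2[OF assms(3)]]) (rule v)
  then show "velocity {0..\<alpha>} c differentiable (at t within {0..\<alpha>})"
    by (rule differentiableI_vector)
qed

text \<open>Taking the normal as an arbitrary field \<open>M\<close> lets one statement serve both
  the surface normal \<open>N\<close> and the constant normal of the plane.\<close>

lemma Darboux_frame_orthonormal:
  assumes "velocity J c t \<noteq> 0" "norm (M t) = 1" "M t \<bullet> velocity J c t = 0"
  shows "tangent J c t \<bullet> tangent J c t = 1" "conormal J c M t \<bullet> conormal J c M t = 1"
    "tangent J c t \<bullet> conormal J c M t = 0" "M t \<bullet> tangent J c t = 0" "M t \<bullet> conormal J c M t = 0"
proof -
  have "norm (tangent J c t) = 1"
    using assms(1) by (simp add: tangent_def)
  then show e: "tangent J c t \<bullet> tangent J c t = 1"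
    by (simp add: norm_eq_1)
  show Me: "M t \<bullet> tangent J c t = 0"
    using assms(3) by (simp add: tangent_def)
  show "conormal J c M t \<bullet> conormal J c M t = 1"
    using norm_cross_dot[of "M t" "tangent J c t"] assms(2) e Me
    by (simp add: conormal_def power2_norm_eq_inner norm_eq_1)
  show "tangent J c t \<bullet> conormal J c M t = 0" "M t \<bullet> conormal J c M t = 0"
    by (simp_all add: conormal_def dot_cross_self)
qed

text \<open>Inner products here depend on the coefficients alone, so equal coefficients in two
  different orthonormal frames give equal first fundamental forms.\<close>

lemma inner_combination_orthonormal:
  fixes e h :: "'a::real_inner"
  assumes "e \<bullet> e = 1" "h \<bullet> h = 1" "e \<bullet> h = 0"
  shows "(x *\<^sub>R e + y *\<^sub>R h) \<bullet> (x' *\<^sub>R e + y' *\<^sub>R h) = x * x' + y * y'"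
  using assms by (simp add: inner_add_left inner_add_right inner_commute)

section \<open>The ruled surface along the normalised axis\<close>

text \<open>The curve and its normal do not enter the right-hand side: the spatial axis and its
  pull-back share one normalising factor.\<close>

lemma norm_rolling_axis:
  assumes "velocity J c t \<noteq> 0" "norm (M t) = 1" "M t \<bullet> velocity J c t = 0"
  shows "norm (rolling_axis J c M kn tg t) = sqrt ((kn t)\<^sup>2 + (tg t)\<^sup>2)"
proof -
  have "rolling_axis J c M kn tg t \<bullet> rolling_axis J c M kn tg t = (kn t)\<^sup>2 + (tg t)\<^sup>2"
    using inner_combination_orthonormal[OF Darboux_frame_orthonormal(1-3)[of c t J M, OF assms],
        of "- tg t" "kn t" "- tg t" "kn t"]
    by (simp add: rolling_axis_def power2_eq_square)
  then show ?thesis by (simp add: norm_eq_sqrt_inner)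
qed

text \<open>
  The normal parts \<open>k\<close>, \<open>s\<close> of the frame equations are kept separate from the coefficients \<open>kn\<close>,
  \<open>tg\<close> of the axis, so that the lemma covers both the surface (\<open>k = kn\<close>, \<open>s = tg\<close>) and the plane
  (\<open>k = s = 0\<close>). Proportionality of the two pairs makes the normal component of the partial
  derivative cancel.
\<close>
lemma ruled_rolling_axis_partials:
  fixes c M :: "real \<Rightarrow> real^3"
    and kn tg :: "real \<Rightarrow> real"
  defines "q \<equiv> \<lambda>t. sqrt ((kn t)\<^sup>2 + (tg t)\<^sup>2)"
  assumes frame: "\<And>s. s \<in> J \<Longrightarrow> velocity J c s \<noteq> 0 \<and> norm (M s) = 1 \<and> M s \<bullet> velocity J c s = 0"
    and t: "t \<in> J"
    and c: "(c has_vector_derivative velocity J c t) (at t within J)"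
    and e: "(tangent J c has_vector_derivative
        norm (velocity J c t) *\<^sub>R (kg *\<^sub>R conormal J c M t + k *\<^sub>R M t)) (at t within J)"
    and h: "(conormal J c M has_vector_derivative
        norm (velocity J c t) *\<^sub>R (- kg *\<^sub>R tangent J c t + s *\<^sub>R M t)) (at t within J)"
    and ks: "kn t * s = tg t * k"
    and a: "((\<lambda>t. kn t / q t) has_vector_derivative a') (at t within J)"
    and b: "((\<lambda>t. tg t / q t) has_vector_derivative b') (at t within J)"
  shows "((\<lambda>x. ruled c (rolling_axis J c M kn tg) (x, u)) has_vector_derivative
        (norm (velocity J c t) + u * (- b' - kn t / q t * norm (velocity J c t) * kg)) *\<^sub>R tangent J c t +
        (u * (a' - tg t / q t * norm (velocity J c t) * kg)) *\<^sub>R conormal J c M t) (at t within J)"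
      (is "(_ has_vector_derivative ?R) _")
    and "((\<lambda>x. ruled c (rolling_axis J c M kn tg) (t, x)) has_vector_derivative
        (- (tg t / q t)) *\<^sub>R tangent J c t + (kn t / q t) *\<^sub>R conormal J c M t) (at u)"
proof -
  let ?e = "tangent J c" and ?h = "conormal J c M" and ?v = "norm (velocity J c t)"
  let ?a = "\<lambda>t. kn t / q t" and ?b = "\<lambda>t. tg t / q t"
  \<comment> \<open>The length of the axis is known only where the frame hypothesis holds, so this
    rewriting is confined to \<open>J\<close>; that suffices for a derivative within
    \<open>J\<close>.\<close>
  have r: "ruled c (rolling_axis J c M kn tg) (x, y) = c x + y *\<^sub>R (?a x *\<^sub>R ?h x - ?b x *\<^sub>R ?e x)"
    if "x \<in> J" for x y
    using norm_rolling_axis[of c x J M kn tg] frame[OF that]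
    by (simp add: ruled_def rolling_axis_def[of J c M] q_def scaleR_diff_right divide_inverse mult.commute)
  have "?v *\<^sub>R ?e t = velocity J c t"
    using frame[OF t] by (simp add: tangent_def)
  then have c': "(c has_vector_derivative ?v *\<^sub>R ?e t) (at t within J)"
    using c by (simp only:)
  note a' = a[folded has_real_derivative_iff_has_vector_derivative]
    and b' = b[folded has_real_derivative_iff_has_vector_derivative]
  have "((\<lambda>x. c x + u *\<^sub>R (?a x *\<^sub>R ?h x - ?b x *\<^sub>R ?e x)) has_vector_derivative
      ?v *\<^sub>R ?e t + u *\<^sub>R ((?a t *\<^sub>R (?v *\<^sub>R (- kg *\<^sub>R ?e t + s *\<^sub>R M t)) + a' *\<^sub>R ?h t) -
        (?b t *\<^sub>R (?v *\<^sub>R (kg *\<^sub>R ?h t + k *\<^sub>R M t)) + b' *\<^sub>R ?e t))) (at t within J)"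
    (is "(_ has_vector_derivative ?L) _")
    by (rule has_vector_derivative_add[OF c' bounded_linear.has_vector_derivative[OF
          bounded_linear_scaleR_right has_vector_derivative_diff[OF
            has_vector_derivative_scaleR[OF a' h] has_vector_derivative_scaleR[OF b' e]]]])
  moreover have "?L = ?R"
  proof -
    have "?a t * s = ?b t * k" using ks by simp
    then have ks': "?a t * (?v * s) = ?b t * (?v * k)" by (metis mult.left_commute)
    \<comment> \<open>The multiple of \<open>M t\<close> is the whole normal component of the
      derivative.\<close>
    have "?L = ?R + (u * (?a t * (?v * s) - ?b t * (?v * k))) *\<^sub>R M t"
      by (simp add: algebra_simps)
    then show ?thesis using ks' by simp
  qed
  ultimately show "((\<lambda>x. ruled c (rolling_axis J c M kn tg) (x, u)) has_vector_derivative ?R) (at t within J)"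
    by (intro has_vector_derivative_transform[OF t r]) simp_all
  have "((\<lambda>x. c t + x *\<^sub>R (?a t *\<^sub>R ?h t - ?b t *\<^sub>R ?e t)) has_vector_derivative
      ?a t *\<^sub>R ?h t - ?b t *\<^sub>R ?e t) (at u)"
    by (auto simp: has_vector_derivative_def intro!: derivative_eq_intros)
  then show "((\<lambda>x. ruled c (rolling_axis J c M kn tg) (t, x)) has_vector_derivative
      (- ?b t) *\<^sub>R ?e t + ?a t *\<^sub>R ?h t) (at u)"
    by (simp add: r[OF t])
qed

section \<open>Differentiability of the axis coefficients\<close>

text \<open>The hypothesis \<open>nz\<close> keeps the argument of the square root away from 0,
  where the root is not differentiable.\<close>

lemma differentiable_divide_sqrt_sum_squares:
  fixes f g :: "real \<Rightarrow> real"
  assumes "f differentiable (at t within J)" "g differentiable (at t within J)"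
    and nz: "(f t)\<^sup>2 + (g t)\<^sup>2 \<noteq> 0"
  shows "(\<lambda>t. f t / sqrt ((f t)\<^sup>2 + (g t)\<^sup>2)) differentiable (at t within J)"
proof -
  have pos: "(f t)\<^sup>2 + (g t)\<^sup>2 > 0"
    using nz by (simp add: order_less_le)
  have "sqrt differentiable (at ((f t)\<^sup>2 + (g t)\<^sup>2) within (\<lambda>t. (f t)\<^sup>2 + (g t)\<^sup>2) ` J)"
    using DERIV_real_sqrt[OF pos] has_field_derivative_at_within real_differentiable_def by blast
  then have "sqrt \<circ> (\<lambda>t. (f t)\<^sup>2 + (g t)\<^sup>2) differentiable (at t within J)"
    using assms by (intro differentiable_chain_within) auto
  then have "(\<lambda>t. sqrt ((f t)\<^sup>2 + (g t)\<^sup>2)) differentiable (at t within J)"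
    by (simp add: o_def)
  then show ?thesis using assms pos by (intro differentiable_divide) auto
qed

text \<open>The frame equations determine the curvatures pointwise but say nothing about their
  regularity. Solving the equation for the derivative of \<open>N\<close> expresses them through
  inner products of that derivative with the frame, divided by the speed, and all these ingredients
  are differentiable.\<close>

lemma Darboux_curvatures_differentiable:
  assumes "0 < \<alpha>" "regular_curve {0..\<alpha>} c" "smooth_on {0..\<alpha>} N"
    and frame: "\<And>s. s \<in> {0..\<alpha>} \<Longrightarrow> norm (N s) = 1 \<and> N s \<bullet> velocity {0..\<alpha>} c s = 0"
    and D: "Darboux_curvatures {0..\<alpha>} c N kg kn tg"
    and t: "t \<in> {0..\<alpha>}"
  shows "kn differentiable (at t within {0..\<alpha>})" "tg differentiable (at t within {0..\<alpha>})"
proof -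
  let ?J = "{0..\<alpha>}"
  let ?e = "tangent ?J c" and ?h = "conormal ?J c N" and ?v = "\<lambda>t. norm (velocity ?J c t)"
  have sm: "smooth_on ?J c" and nz: "\<And>s. s \<in> ?J \<Longrightarrow> velocity ?J c s \<noteq> 0"
    using assms(2) by (auto simp: regular_curve_def)
  have d: "?e differentiable (at t within ?J)" "?h differentiable (at t within ?J)"
    using D t unfolding Darboux_curvatures_def Let_def by (blast intro: differentiableI_vector)+
  note N1 = smooth_on_interval_differentiable(2)[OF assms(3,1) t]
  obtain c2 where c2: "(velocity ?J c has_derivative c2) (at t within ?J)"
    using smooth_on_interval_differentiable(2)[OF sm assms(1) t] by (auto simp: differentiable_def)
  have v: "?v differentiable (at t within ?J)"
    using has_derivative_compose[OF c2 has_derivative_norm[OF nz[OF t]]] by (rule differentiableI)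
  have N': "velocity ?J N s = ?v s *\<^sub>R (- kn s *\<^sub>R ?e s - tg s *\<^sub>R ?h s)" if "s \<in> ?J" for s
    using D that vector_derivative_within_cbox[of 0 \<alpha> s N] assms(1)
    unfolding Darboux_curvatures_def Let_def by (auto simp: box_real)
  have eq: "- (velocity ?J N s \<bullet> ?e s) / ?v s = kn s" "- (velocity ?J N s \<bullet> ?h s) / ?v s = tg s"
    if s: "s \<in> ?J" for s
    using Darboux_frame_orthonormal[OF nz[OF s], of N] frame[OF s] nz[OF s]
    by (simp_all add: N'[OF s] inner_diff_left inner_commute[of "?h s" "?e s"])
  have "(\<lambda>s. - (velocity ?J N s \<bullet> ?e s) / ?v s) differentiable (at t within ?J)"
    using N1 d v nz[OF t] by (intro differentiable_divide differentiable_minus differentiable_inner) auto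
  then show "kn differentiable (at t within ?J)"
    \<comment> \<open>The formula holds on the whole interval, so the radius 1 is arbitrary.\<close>
    by (rule differentiable_transform_within[OF _ zero_less_one t]) (rule eq)
  have "(\<lambda>s. - (velocity ?J N s \<bullet> ?h s) / ?v s) differentiable (at t within ?J)"
    using N1 d v nz[OF t] by (intro differentiable_divide differentiable_minus differentiable_inner) auto
  then show "tg differentiable (at t within ?J)"
    by (rule differentiable_transform_within[OF _ zero_less_one t]) (rule eq)
qed

section \<open>Transfer of regularity, and the frame of a plane curve\<close>

text \<open>The coefficients E, F, G determine the length of every combination of the partial
  derivatives, hence also which combinations vanish.\<close>

lemma regular_parametrization_isometric:
  assumes "isometric_parametrizations J D r r'" "regular_parametrization J D r"
  shows "regular_parametrization J D r'"
  unfolding regular_parametrization_def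
proof (intro ballI allI impI)
  fix p a b
  assume p: "p \<in> D" and z: "a *\<^sub>R partial_t J r' p + b *\<^sub>R partial_u r' p = 0"
  have sq: "(a *\<^sub>R x + b *\<^sub>R y) \<bullet> (a *\<^sub>R x + b *\<^sub>R y) =
      a * a * (x \<bullet> x) + 2 * a * b * (x \<bullet> y) + b * b * (y \<bullet> y)" for x y :: "real^3"
    by (simp add: inner_add_left inner_add_right inner_commute algebra_simps)
  have "(a *\<^sub>R partial_t J r p + b *\<^sub>R partial_u r p) \<bullet> (a *\<^sub>R partial_t J r p + b *\<^sub>R partial_u r p) =
      (a *\<^sub>R partial_t J r' p + b *\<^sub>R partial_u r' p) \<bullet> (a *\<^sub>R partial_t J r' p + b *\<^sub>R partial_u r' p)"
    using assms(1) p unfolding isometric_parametrizations_def sq by auto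
  then have "a *\<^sub>R partial_t J r p + b *\<^sub>R partial_u r p = 0"
    using z by simp
  then show "a = 0 \<and> b = 0"
    using assms(2) p unfolding regular_parametrization_def by blast
qed

lemma velocity_in_plane:
  assumes "0 < \<alpha>" "smooth_on {0..\<alpha>} c" "\<And>s. s \<in> {0..\<alpha>} \<Longrightarrow> n \<bullet> c s = d" "t \<in> {0..\<alpha>}"
  shows "n \<bullet> velocity {0..\<alpha>} c t = 0"
proof -
  have "((\<lambda>s. n \<bullet> c s) has_vector_derivative n \<bullet> velocity {0..\<alpha>} c t) (at t within {0..\<alpha>})"
    using smooth_on_interval_differentiable(1)[OF assms(2,1,4)]
    by (rule bounded_linear.has_vector_derivative[OF bounded_linear_inner_right])
  moreover have "((\<lambda>s. n \<bullet> c s) has_vector_derivative 0) (at t within {0..\<alpha>})"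
    by (rule has_vector_derivative_transform[OF assms(4), of _ "\<lambda>_. d"]) (use assms(3) in auto)
  ultimately show ?thesis
    using vector_derivative_unique_within_closed_interval[OF assms(1), of t "\<lambda>s. n \<bullet> c s"] assms(4)
    by (simp only: box_real)
qed

text \<open>Since \<open>n\<close> is constant, only the tangent is differentiated, and
  \<open>cross3 n\<close> squares to minus the identity on vectors orthogonal to \<open>n\<close>.
  This supplies the second frame equation of the development, with no normal term.\<close>

lemma conormal_plane_derivative:
  assumes "(tangent J c has_vector_derivative v *\<^sub>R k *\<^sub>R conormal J c (\<lambda>_. n) t) (at t within J)"
    and "norm n = 1" "n \<bullet> tangent J c t = 0"
  shows "(conormal J c (\<lambda>_. n) has_vector_derivative v *\<^sub>R (- k *\<^sub>R tangent J c t)) (at t within J)"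
proof -
  have "bounded_linear (cross3 n)"
    using bilinear_cross bilinear_conv_bounded_bilinear bounded_bilinear.bounded_linear_right by blast
  then have "((\<lambda>s. cross3 n (tangent J c s)) has_vector_derivative
      cross3 n (v *\<^sub>R k *\<^sub>R conormal J c (\<lambda>_. n) t)) (at t within J)"
    using assms(1) by (rule bounded_linear.has_vector_derivative)
  moreover have "cross3 n (cross3 n (tangent J c t)) = - tangent J c t"
    using assms(2,3) by (simp add: Lagrange norm_eq_1)
  ultimately show ?thesis
    by (simp add: conormal_def[abs_def] cross_mult_right)
qed

section \<open>Comparison of the two ribbons\<close>

theorem proposition3p4:
  fixes S P :: "(real^3) set"
    and \<alpha> d :: real
    and J :: "real set"
    and \<gamma> N \<gamma>' :: "real \<Rightarrow> real^3"
    and \<kappa>g \<kappa>n \<tau>g wm wp :: "real \<Rightarrow> real"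
    and n :: "real^3"
    and r r' :: "real \<times> real \<Rightarrow> real^3"
    and D :: "(real \<times> real) set"
  assumes J: "0 < \<alpha>" "J = {0..\<alpha>}"
    and surface: "regular_surface S"
    and curve: "regular_curve J \<gamma>" "\<gamma> ` J \<subseteq> S" "\<gamma> 0 = 0"
    and normal: "unit_normal_along S J \<gamma> N"
    and curvatures: "Darboux_curvatures J \<gamma> N \<kappa>g \<kappa>n \<tau>g"
    and \<kappa>n_nonzero: "\<forall>t\<in>J. \<kappa>n t \<noteq> 0"
    and plane: "norm n = 1" "P = {x. n \<bullet> x = d}"
    and development: "development_curve J \<gamma> \<kappa>g P n \<gamma>'"
    and widths: "\<forall>t\<in>J. 0 < wm t \<and> 0 < wp t"
    and domain: "D = ribbon_domain J wm wp"
    and surface_ribbon: "r = ruled \<gamma> (rolling_axis J \<gamma> N \<kappa>n \<tau>g)"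
    and surface_ribbon_regular: "regular_parametrization J D r"
    and planar_ribbon: "r' = ruled \<gamma>' (rolling_axis J \<gamma>' (\<lambda>_. n) \<kappa>n \<tau>g)"
  shows "isometric_parametrizations J D r r'
    \<and> regular_parametrization J D r' \<and> r' ` D \<subseteq> P
    \<and> (\<forall>t u. (t, u) \<in> D \<longrightarrow>
        r' (t, u) = \<gamma>' t + u *\<^sub>R (rolling_axis J \<gamma>' (\<lambda>_. n) \<kappa>n \<tau>g t
                              /\<^sub>R sqrt ((\<kappa>n t)\<^sup>2 + (\<tau>g t)\<^sup>2)))"
proof -
  let ?v = "\<lambda>t. norm (velocity J \<gamma> t)" and ?q = "\<lambda>t. sqrt ((\<kappa>n t)\<^sup>2 + (\<tau>g t)\<^sup>2)"
  have sm: "smooth_on J \<gamma>" "smooth_on J N" "smooth_on J \<gamma>'"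
    and nz: "\<And>t. t \<in> J \<Longrightarrow> velocity J \<gamma> t \<noteq> 0"
    and speed: "\<And>t. t \<in> J \<Longrightarrow> norm (velocity J \<gamma>' t) = ?v t"
    and inP: "\<And>t. t \<in> J \<Longrightarrow> n \<bullet> \<gamma>' t = d"
    and curv: "signed_curvature J \<gamma>' n \<kappa>g"
    using curve normal development plane(2)
    unfolding regular_curve_def unit_normal_along_def development_curve_def by blast+
  have frame: "velocity J \<gamma> t \<noteq> 0 \<and> norm (N t) = 1 \<and> N t \<bullet> velocity J \<gamma> t = 0" if "t \<in> J" for t
    using that nz normal unit_normal_orthogonal_velocity[OF J(1), of \<gamma> S N t] sm(1) curve(2) J(2)
    unfolding unit_normal_along_def by blast
  \<comment> \<open>The planar velocity is nonzero because the speeds agree, and orthogonal to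
    \<open>n\<close> because the curve stays in \<open>P\<close>.\<close>
  have frame': "velocity J \<gamma>' t \<noteq> 0 \<and> norm n = 1 \<and> n \<bullet> velocity J \<gamma>' t = 0" if "t \<in> J" for t
    using that nz[OF that] speed[OF that] plane(1) velocity_in_plane[OF J(1), of \<gamma>' n d t] sm(3) inP J(2)
    by auto
  have diff: "\<kappa>n differentiable (at t within J)" "\<tau>g differentiable (at t within J)" if "t \<in> J" for t
    using Darboux_curvatures_differentiable[OF J(1), of \<gamma> N \<kappa>g \<kappa>n \<tau>g t]
      curve(1) sm(2) frame curvatures that J(2) by auto
  have q: "(\<kappa>n t)\<^sup>2 + (\<tau>g t)\<^sup>2 \<noteq> 0" if "t \<in> J" for t
    using \<kappa>n_nonzero that by (simp add: sum_power2_eq_zero_iff)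
  \<comment> \<open>The values of these derivatives never matter, only that both ribbons use the
    same ones.\<close>
  define a' where "a' t = vector_derivative (\<lambda>t. \<kappa>n t / ?q t) (at t within J)" for t
  define b' where "b' t = vector_derivative (\<lambda>t. \<tau>g t / ?q t) (at t within J)" for t
  have a: "((\<lambda>t. \<kappa>n t / ?q t) has_vector_derivative a' t) (at t within J)" if t: "t \<in> J" for t
    using differentiable_divide_sqrt_sum_squares[OF diff[OF t] q[OF t]]
    unfolding a'_def by (simp only: vector_derivative_works)
  have b: "((\<lambda>t. \<tau>g t / ?q t) has_vector_derivative b' t) (at t within J)" if t: "t \<in> J" for t
    using differentiable_divide_sqrt_sum_squares[OF diff(2)[OF t] diff(1)[OF t]] q[OF t]
    unfolding b'_def by (simp only: vector_derivative_works add.commute[of "(\<tau>g _)\<^sup>2"] simp_thms)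
  \<comment> \<open>\<open>A\<close> and \<open>B\<close> involve no frame vector, so they can serve
    as coefficients for both ribbons.\<close>
  define A where "A t u = ?v t + u * (- b' t - \<kappa>n t / ?q t * ?v t * \<kappa>g t)" for t u
  define B where "B t u = u * (a' t - \<tau>g t / ?q t * ?v t * \<kappa>g t)" for t u
  let ?e = "tangent J \<gamma>" and ?h = "conormal J \<gamma> N"
  let ?e' = "tangent J \<gamma>'" and ?h' = "conormal J \<gamma>' (\<lambda>_. n)"
  have c: "(\<gamma> has_vector_derivative velocity J \<gamma> t) (at t within J)"
    "(\<gamma>' has_vector_derivative velocity J \<gamma>' t) (at t within J)" if "t \<in> J" for t
    using smooth_on_interval_differentiable(1)[OF _ J(1)] sm that J(2) by blast+
  have rt: "((\<lambda>x. r (x, u)) has_vector_derivative A t u *\<^sub>R ?e t + B t u *\<^sub>R ?h t) (at t within J)"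
    and ru: "((\<lambda>x. r (t, x)) has_vector_derivative
        (- (\<tau>g t / ?q t)) *\<^sub>R ?e t + (\<kappa>n t / ?q t) *\<^sub>R ?h t) (at u)" if t: "t \<in> J" for t u
  proof -
    note D = curvatures[unfolded Darboux_curvatures_def Let_def, rule_format, OF t]
    \<comment> \<open>Here \<open>k\<close> is \<kappa>n and \<open>s\<close> is \<tau>g at
      \<open>t\<close>, so the premise left open is commutativity of multiplication.\<close>
    note R = ruled_rolling_axis_partials[OF frame t c(1)[OF t] conjunct1[OF D]
        conjunct1[OF conjunct2[OF D]] _ a[OF t] b[OF t], of u]
    show "((\<lambda>x. r (x, u)) has_vector_derivative A t u *\<^sub>R ?e t + B t u *\<^sub>R ?h t) (at t within J)"
      using R(1) by (simp add: surface_ribbon A_def B_def)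
    show "((\<lambda>x. r (t, x)) has_vector_derivative
        (- (\<tau>g t / ?q t)) *\<^sub>R ?e t + (\<kappa>n t / ?q t) *\<^sub>R ?h t) (at u)"
      using R(2) by (simp add: surface_ribbon)
  qed
  have rt': "((\<lambda>x. r' (x, u)) has_vector_derivative A t u *\<^sub>R ?e' t + B t u *\<^sub>R ?h' t) (at t within J)"
    and ru': "((\<lambda>x. r' (t, x)) has_vector_derivative
        (- (\<tau>g t / ?q t)) *\<^sub>R ?e' t + (\<kappa>n t / ?q t) *\<^sub>R ?h' t) (at u)" if t: "t \<in> J" for t u
  proof -
    have e: "(?e' has_vector_derivative norm (velocity J \<gamma>' t) *\<^sub>R \<kappa>g t *\<^sub>R ?h' t) (at t within J)"
      using curv t unfolding signed_curvature_def by blast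
    have "n \<bullet> ?e' t = 0" using frame'[OF t] by (simp add: tangent_def)
    note h = conormal_plane_derivative[OF e plane(1) this]
    \<comment> \<open>In the plane the normal terms are absent and proportionality reads 0 = 0;
      equality of speeds then turns the coefficients into the same \<open>A\<close> and
      \<open>B\<close>.\<close>
    note R = ruled_rolling_axis_partials[where M = "\<lambda>_. n" and k = 0 and s = 0 and kg = "\<kappa>g t",
        OF frame' t c(2)[OF t] _ _ _ a[OF t] b[OF t], of u]
    show "((\<lambda>x. r' (x, u)) has_vector_derivative A t u *\<^sub>R ?e' t + B t u *\<^sub>R ?h' t) (at t within J)"
      using R(1) e h by (simp add: planar_ribbon A_def B_def speed[OF t])
    show "((\<lambda>x. r' (t, x)) has_vector_derivative
        (- (\<tau>g t / ?q t)) *\<^sub>R ?e' t + (\<kappa>n t / ?q t) *\<^sub>R ?h' t) (at u)"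
      using R(2) e h by (simp add: planar_ribbon)
  qed
  \<comment> \<open>Derivatives within a nondegenerate closed interval are unique even at its
    endpoints.\<close>
  have pt: "partial_t J f p = w"
    if "fst p \<in> J" "((\<lambda>x. f (x, snd p)) has_vector_derivative w) (at (fst p) within J)"
    for f :: "real \<times> real \<Rightarrow> real^3" and p w
    using that vector_derivative_within_cbox[of 0 \<alpha> "fst p"] J by (simp add: box_real)
  have DJ: "fst p \<in> J" if "p \<in> D" for p
    using that domain by (auto simp: ribbon_domain_def)
  have iso: "isometric_parametrizations J D r r'"
    unfolding isometric_parametrizations_def partials_exist_def
  proof (intro conjI ballI)
    fix p assume "p \<in> D"
    then have t: "fst p \<in> J" by (rule DJ)
    show "(\<lambda>s. r (s, snd p)) differentiable (at (fst p) within J)"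
      "(\<lambda>v. r (fst p, v)) differentiable (at (snd p))"
      "(\<lambda>s. r' (s, snd p)) differentiable (at (fst p) within J)"
      "(\<lambda>v. r' (fst p, v)) differentiable (at (snd p))"
      using rt[OF t] ru[OF t] rt'[OF t] ru'[OF t] by (blast intro: differentiableI_vector)+
    note on = inner_combination_orthonormal[OF Darboux_frame_orthonormal(1-3)[of \<gamma> "fst p" J N]]
      inner_combination_orthonormal[OF Darboux_frame_orthonormal(1-3)[of \<gamma>' "fst p" J "\<lambda>_. n"]]
    show "partial_t J r p \<bullet> partial_t J r p = partial_t J r' p \<bullet> partial_t J r' p"
      "partial_t J r p \<bullet> partial_u r p = partial_t J r' p \<bullet> partial_u r' p"
      "partial_u r p \<bullet> partial_u r p = partial_u r' p \<bullet> partial_u r' p"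
      using frame[OF t] frame'[OF t] by (simp_all only: pt[OF t rt[OF t]] pt[OF t rt'[OF t]]
        vector_derivative_at[OF ru[OF t]] vector_derivative_at[OF ru'[OF t]] on simp_thms)
  qed
  have formula: "r' (t, u) = \<gamma>' t + u *\<^sub>R (rolling_axis J \<gamma>' (\<lambda>_. n) \<kappa>n \<tau>g t /\<^sub>R ?q t)"
    if "(t, u) \<in> D" for t u
    using norm_rolling_axis[of \<gamma>' t J "\<lambda>_. n" \<kappa>n \<tau>g] frame'[of t] DJ[OF that]
    by (simp add: planar_ribbon ruled_def)
  have "r' p \<in> P" if "p \<in> D" for p
  proof -
    obtain t u where p: "p = (t, u)" by (cases p)
    have t: "t \<in> J" using DJ[OF that] p by simp
    have "n \<bullet> rolling_axis J \<gamma>' (\<lambda>_. n) \<kappa>n \<tau>g t = 0"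
      using Darboux_frame_orthonormal(4,5)[of \<gamma>' t J "\<lambda>_. n"] frame'[OF t]
      by (simp add: rolling_axis_def inner_diff_right)
    then show ?thesis
      using inP[OF t] by (simp add: p planar_ribbon ruled_def plane(2) inner_add_right)
  qed
  then show ?thesis
    using iso regular_parametrization_isometric[OF iso surface_ribbon_regular] formula by blast
qed

end
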